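(* Let $G=(V,E)$ be a finite loopless directed graph without parallel edges, let $c:E\to[q]$ be a role assignment, and fix two distinct roles $r,s\in[q]$. Represent the directed edges of $G$ as the edges of the bipartite tail–head graph of $G$. Then reversing the roles $r$ and $s$ (replacing $r$ by $s$ and $s$ by $r$) along an even cycle of the tail–head graph whose edge roles under $c$ alternate $r,s,r,s,\dots$ produces another assignment in $\mathcal I(c)$. Conversely, if $c'\in\mathcal I(c)$ and every edge $e$ with $c'(e)\ne c(e)$ changes from $r$ to $s$ or from $s$ to $r$, then the set of changed edges, viewed in the tail–head graph, decomposes into edge-disjoint alternating closed trails, and hence into edge-disjoint alternating cycles (alternating means that the roles under $c$ of cyclically consecutive edges alternate between $r$ and $s$).
   Context: $[q]=\{1,\dots,q\}$. For a role assignment $c:E\to[q]$, $v\in V$ and $r\in[q]$, put $d_r^+(v;c)=|\{(v,w)\in E:c(v,w)=r\}|$ and $d_r^-(v;c)=|\{(u,v)\in E:c(u,v)=r\}|$. The fixed-role incidence fibre is $\mathcal I(c)=\{c':E\to[q]\;:\;d_r^\pm(v;c')=d_r^\pm(v;c)\text{ for every }v\in V,\ r\in[q]\}$. The bipartite tail–head graph of $G$ has a tail copy $v^+$ and a head copy $v^-$ of every $v\in V$, and each directed edge $(u,v)\in E$ becomes the bipartite edge $u^+v^-$, carrying the role $c(u,v)$. *)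

theory Defs
  imports
    "Graph_Theory.Pair_Digraph"
    "HOL-Library.FuncSet"
    "HOL-Library.Disjoint_Sets"
    "HOL-Combinatorics.Transposition"
begin

text \<open>
  Directed graphs without parallel edges are Graph-Theory's pair digraphs, whose arc set is a set
  of ordered pairs; finite and loopless ones form the locale \<^locale>\<open>pair_digraph\<close>.
  Assignments are extensional functions, so that two of them are equal as soon as they agree on
  the arc set.
\<close>

definition role_assignments :: "'a pair_pre_digraph \<Rightarrow> nat \<Rightarrow> ('a \<times> 'a \<Rightarrow> nat) set" where
  "role_assignments G q = (parcs G \<rightarrow>\<^sub>E {1..q})"

definition out_role_degree ::
    "'a pair_pre_digraph \<Rightarrow> ('a \<times> 'a \<Rightarrow> nat) \<Rightarrow> nat \<Rightarrow> 'a \<Rightarrow> nat" where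
  "out_role_degree G c r v = card {e \<in> out_arcs (with_proj G) v. c e = r}"

definition in_role_degree ::
    "'a pair_pre_digraph \<Rightarrow> ('a \<times> 'a \<Rightarrow> nat) \<Rightarrow> nat \<Rightarrow> 'a \<Rightarrow> nat" where
  "in_role_degree G c r v = card {e \<in> in_arcs (with_proj G) v. c e = r}"

definition incidence_fibre ::
    "'a pair_pre_digraph \<Rightarrow> nat \<Rightarrow> ('a \<times> 'a \<Rightarrow> nat) \<Rightarrow> ('a \<times> 'a \<Rightarrow> nat) set" where
  "incidence_fibre G q c =
    {c' \<in> role_assignments G q. \<forall>v \<in> pverts G. \<forall>r \<in> {1..q}.
       out_role_degree G c' r v = out_role_degree G c r v \<and>
       in_role_degree G c' r v = in_role_degree G c r v}"

text \<open>
  The tail copy of \<open>v\<close> is \<open>Inl v\<close>, its head copy is \<open>Inr v\<close>. As usual in Graph-Theory, an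
  undirected graph is a symmetric digraph, so every undirected edge is present as two mutually
  reverse arcs; \<open>tail_head_edge\<close> sends both of them to the directed edge of \<open>G\<close> they stand for.
\<close>

definition tail_head_graph :: "'a pair_pre_digraph \<Rightarrow> ('a + 'a) pair_pre_digraph" where
  "tail_head_graph G =
    \<lparr> pverts = Inl ` pverts G \<union> Inr ` pverts G,
      parcs = (\<Union>(u, v) \<in> parcs G. {(Inl u, Inr v), (Inr v, Inl u)}) \<rparr>"

fun tail_head_edge :: "('a + 'a) \<times> ('a + 'a) \<Rightarrow> 'a \<times> 'a" where
  "tail_head_edge (Inl u, Inr v) = (u, v)"
| "tail_head_edge (Inr v, Inl u) = (u, v)"

lemma pair_graph_tail_head_graph:
  assumes "pair_digraph G"
  shows "pair_graph (tail_head_graph G)"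
proof -
  interpret pair_digraph G by fact
  show ?thesis
    by unfold_locales
      (auto simp: tail_head_graph_def symmetric_def sym_def arcs_ends_def arc_to_ends_def
        with_proj_def image_iff pair_finite_verts pair_finite_arcs in_arcsD1 in_arcsD2)
qed

lemma tail_head_edge_eq_iff:
  assumes "a \<in> parcs (tail_head_graph G)" "b \<in> parcs (tail_head_graph G)"
  shows "tail_head_edge a = tail_head_edge b \<longleftrightarrow> a = b \<or> a = prod.swap b"
  using assms by (auto simp: tail_head_graph_def)

lemma tail_head_edge_image: "tail_head_edge ` parcs (tail_head_graph G) = parcs G"
  by (force simp: tail_head_graph_def image_iff)

text \<open>
  A walk is given by its list of arcs. In a symmetric digraph, \<open>u, v, u\<close> is a directed cycle; the
  distinctness condition on undirected edges rules this out, and makes a closed walk a closed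
  trail in the undirected sense.
\<close>

definition th_closed_trail ::
    "'a pair_pre_digraph \<Rightarrow> (('a + 'a) \<times> ('a + 'a)) list \<Rightarrow> bool" where
  "th_closed_trail G p \<longleftrightarrow>
    wf_digraph.closed_w (with_proj (tail_head_graph G)) p \<and> distinct (map tail_head_edge p)"

definition th_cycle ::
    "'a pair_pre_digraph \<Rightarrow> (('a + 'a) \<times> ('a + 'a)) list \<Rightarrow> bool" where
  "th_cycle G p \<longleftrightarrow>
    pre_digraph.cycle (with_proj (tail_head_graph G)) p \<and> distinct (map tail_head_edge p)"

definition th_edges :: "(('a + 'a) \<times> ('a + 'a)) list \<Rightarrow> ('a \<times> 'a) set" where
  "th_edges p = tail_head_edge ` set p"

definition alternating ::
    "('a \<times> 'a \<Rightarrow> nat) \<Rightarrow> nat \<Rightarrow> nat \<Rightarrow> (('a + 'a) \<times> ('a + 'a)) list \<Rightarrow> bool" where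
  "alternating c r s p \<longleftrightarrow>
    (\<forall>i < length p.
       {c (tail_head_edge (p ! i)), c (tail_head_edge (p ! (Suc i mod length p)))} = {r, s})"

definition reverse_roles ::
    "nat \<Rightarrow> nat \<Rightarrow> ('a \<times> 'a) set \<Rightarrow> ('a \<times> 'a \<Rightarrow> nat) \<Rightarrow> 'a \<times> 'a \<Rightarrow> nat" where
  "reverse_roles r s S c = (\<lambda>e. if e \<in> S then transpose r s (c e) else c e)"

definition changed_edges ::
    "'a pair_pre_digraph \<Rightarrow> ('a \<times> 'a \<Rightarrow> nat) \<Rightarrow> ('a \<times> 'a \<Rightarrow> nat) \<Rightarrow> ('a \<times> 'a) set" where
  "changed_edges G c c' = {e \<in> parcs G. c' e \<noteq> c e}"

end

theory Submission
  imports Defs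
begin

text \<open>
  Orient every changed edge of one role from tail copy to head copy, and every changed edge of
  the other role from head copy to tail copy. A closed walk alternates in roles iff it, or its
  reversal, runs along this orientation, since walks in a bipartite graph alternate between the two
  sides. Membership in the fibre says exactly that the oriented arc set has equal in- and
  out-degree at every vertex. Closed trails have this property, and conversely a finite
  balanced arc set decomposes into directed cycles, by removing one cycle at a time.
\<close>

section \<open>Balanced arc sets\<close>

text \<open>The Eulerian condition. Ranging over the whole vertex type avoids carrying a vertex set
  along; vertices that \<open>A\<close> does not touch satisfy it trivially.\<close>

definition balanced :: "'b rel \<Rightarrow> bool" where
  "balanced A \<longleftrightarrow> (\<forall>x. card {a \<in> A. fst a = x} = card {a \<in> A. snd a = x})"

text \<open>A walk leaves each vertex as often as it enters it, except that the start
  \<open>u\<close> is left once more and the end \<open>v\<close> entered once more; the indicators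
  correct for this and cancel when \<open>u = v\<close>.\<close>

lemma pcas_count:
  "pcas u p v \<Longrightarrow>
    length (filter (\<lambda>a. fst a = x) p) + (if v = x then 1 else 0) =
    length (filter (\<lambda>a. snd a = x) p) + (if u = x then 1 else 0)"
  by (induct u p v rule: pcas.induct) (auto split: if_splits)

lemma balanced_closed_trail:
  assumes "pcas u p u" "distinct p"
  shows "balanced (set p)"
  unfolding balanced_def
proof
  fix x
  have "{a \<in> set p. P a} = Collect P \<inter> set p" for P by auto
  then show "card {a \<in> set p. fst a = x} = card {a \<in> set p. snd a = x}"
    using pcas_count[OF assms(1), of x] by (simp add: distinct_length_filter[OF assms(2), symmetric])
qed

lemma balanced_Diff:
  assumes "finite A" "B \<subseteq> A" "balanced A" "balanced B"
  shows "balanced (A - B)"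
proof -
  have "{a \<in> A - B. P a} = {a \<in> A. P a} - {a \<in> B. P a}" for P by auto
  moreover have "card ({a \<in> A. P a} - {a \<in> B. P a}) = card {a \<in> A. P a} - card {a \<in> B. P a}" for P
    using assms(1,2) by (intro card_Diff_subset) (auto intro: finite_subset)
  ultimately show ?thesis using assms(3,4) by (simp add: balanced_def)
qed

text \<open>Walking backwards never gets stuck: a vertex with an outgoing arc has an incoming one,
  whose tail again has an outgoing arc. A finite acyclic relation is well-founded, so a minimal such
  vertex would contradict this.\<close>

lemma balanced_not_acyclic:
  assumes "finite A" "balanced A" "A \<noteq> {}"
  shows "\<not> acyclic A"
proof
  assume "acyclic A"
  then have "wf A" using assms(1) by (simp add: finite_acyclic_wf)
  moreover obtain x where "x \<in> fst ` A" using assms(3) by auto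
  ultimately obtain z where z: "z \<in> fst ` A" "\<And>y. (y, z) \<in> A \<Longrightarrow> y \<notin> fst ` A"
    by (metis wfE_min)
  from z(1) have "card {a \<in> A. fst a = z} \<noteq> 0" using assms(1) by auto
  then have "card {a \<in> A. snd a = z} \<noteq> 0" using assms(2) by (simp add: balanced_def)
  then have "{a \<in> A. snd a = z} \<noteq> {}" by (metis card.empty)
  then obtain a where "a \<in> A" "snd a = z" by blast
  then show False using z(2)[of "fst a"] by force
qed

context pair_wf_digraph
begin

lemma balanced_set_closed_w:
  assumes "closed_w p" "distinct p"
  shows "balanced (set p)"
  using assms by (auto simp: closed_w_def awalk_def intro: balanced_closed_trail)

lemma balanced_obtains_cycle:
  assumes "finite A" "A \<subseteq> parcs G" "balanced A" "A \<noteq> {}"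
  obtains p where "cycle p" "set p \<subseteq> A"
proof -
  \<comment> \<open>Closed walks are reduced to cycles inside the subgraph with arc set
    \<open>A\<close>, so that the cycle found stays within \<open>A\<close>; it is then read as a
    cycle of \<open>G\<close>.\<close>
  define H where "H = G\<lparr>parcs := A\<rparr>"
  interpret H: pair_wf_digraph H
    using assms(2) by unfold_locales (auto simp: H_def in_arcsD1 in_arcsD2)
  obtain x where "(x, x) \<in> A\<^sup>+"
    using balanced_not_acyclic[OF assms(1,3,4)] by (auto simp: acyclic_def)
  then obtain p where "H.awalk x p x" "p \<noteq> []"
    using H.reachable1_awalk[of x x] by (auto simp: H_def)
  then have "H.closed_w p" by (auto simp: H.closed_w_def)
  then obtain p u where "H.awalk u p u" "distinct (tl (pawalk_verts u p))" "p \<noteq> []"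
    using H.closed_w_imp_cycle unfolding H.cycle_def by blast
  moreover from this have "awalk u p u" "set p \<subseteq> A"
    using assms(2) unfolding H.awalk_def awalk_def by (auto simp: H_def)
  ultimately have "cycle p" "set p \<subseteq> A" by (auto simp: cycle_def)
  then show thesis by (rule that)
qed

lemma balanced_partition_cycles:
  assumes "finite A" "A \<subseteq> parcs G" "balanced A"
  shows "\<exists>P. partition_on A P \<and> (\<forall>C \<in> P. \<exists>p. cycle p \<and> set p = C)"
  using assms
proof (induct A rule: finite_psubset_induct)
  case (psubset A)
  show ?case
  proof (cases "A = {}")
    case True
    then show ?thesis by (intro exI[of _ "{}"]) (simp add: partition_on_def)
  next
    case False
    then obtain p where p: "cycle p" "set p \<subseteq> A"
      using balanced_obtains_cycle psubset.hyps(1) psubset.prems by blast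
    \<comment> \<open>\<open>cycle\<close> asks for distinct vertices; \<open>cycle_conv\<close>
      supplies the distinctness of the arcs, by which the cycle is balanced and can be
      removed.\<close>
    then have "closed_w p" "distinct p" "p \<noteq> []"
      by (auto simp: cycle_conv closed_w_def)
    have "balanced (A - set p)"
      using p \<open>closed_w p\<close> \<open>distinct p\<close> psubset.hyps(1) psubset.prems
      by (auto intro: balanced_Diff balanced_set_closed_w)
    moreover have "A - set p \<subset> A" using p(2) hd_in_set[OF \<open>p \<noteq> []\<close>] by blast
    ultimately obtain P where P: "partition_on (A - set p) P" "\<forall>C \<in> P. \<exists>p. cycle p \<and> set p = C"
      using psubset.hyps(2)[of "A - set p"] psubset.prems by blast
    have "disjnt (set p) (\<Union>P)"
      using partition_onD1[OF P(1)] by (auto simp: disjnt_iff)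
    then have "partition_on A (insert (set p) P)"
      using P(1) p \<open>p \<noteq> []\<close> by (simp add: partition_on_insert)
    then show ?thesis using P(2) p(1) by blast
  qed
qed

lemma closed_w_snd_eq_fst:
  assumes "closed_w p" "i < length p"
  shows "snd (p ! i) = fst (p ! (Suc i mod length p))"
proof -
  \<comment> \<open>Stated for open walks, since the tail of a closed walk is not closed. The last
    arc ends in \<open>v\<close>, which for a closed walk is the source of \<open>p ! 0\<close>: the
    wrap-around case of the index.\<close>
  have step: "snd (p ! i) = (if Suc i < length p then fst (p ! Suc i) else v)"
    if "pcas u p v" "i < length p" for u v p i
    using that
  proof (induct u p v arbitrary: i rule: pcas.induct)
    case (2 u e es v)
    then show ?case by (cases i; cases es) auto
  qed simp
  obtain u where u: "pcas u p u" "p \<noteq> []"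
    using assms(1) by (auto simp: closed_w_def awalk_def)
  then have "fst (p ! 0) = u" by (cases p) auto
  then show ?thesis
    using step[OF u(1) assms(2)] assms(2) by (cases "Suc i = length p") auto
qed

end

section \<open>Orientations by role\<close>

text \<open>For an arc of the tail-head graph, \<open>isl (fst a)\<close> says that it runs from
  tail copy to head copy. Keeping \<open>t\<close> and \<open>t'\<close> as parameters covers both
  directions of traversal.\<close>

definition role_oriented ::
    "('a \<times> 'a \<Rightarrow> nat) \<Rightarrow> nat \<Rightarrow> nat \<Rightarrow> (('a + 'a) \<times> ('a + 'a)) set \<Rightarrow> bool" where
  "role_oriented c t t' A \<longleftrightarrow>
    (\<forall>a \<in> A. c (tail_head_edge a) = (if isl (fst a) then t else t'))"

lemma tail_head_arc_cases:
  assumes "a \<in> parcs (tail_head_graph G)"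
  obtains u v where "(u, v) \<in> parcs G" "a = (Inl u, Inr v)"
  | u v where "(u, v) \<in> parcs G" "a = (Inr v, Inl u)"
  using assms by (auto simp: tail_head_graph_def)

lemma isl_snd_tail_head_arc:
  "a \<in> parcs (tail_head_graph G) \<Longrightarrow> isl (snd a) \<longleftrightarrow> \<not> isl (fst a)"
  by (auto elim: tail_head_arc_cases)

text \<open>Side and role each take two values. The side flips at every step, cyclically, so the
  role flips too exactly if it is a function of the side; the existential leaves open which role
  goes with which side.\<close>

lemma alternating_iff_role_oriented:
  assumes "pair_digraph G" "wf_digraph.closed_w (with_proj (tail_head_graph G)) p" "r \<noteq> s"
  shows "alternating c r s p \<longleftrightarrow> (\<exists>t t'. {t, t'} = {r, s} \<and> role_oriented c t t' (set p))"
proof -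
  interpret H: pair_graph "tail_head_graph G"
    using assms(1) by (rule pair_graph_tail_head_graph)
  let ?role = "\<lambda>i. c (tail_head_edge (p ! i))" and ?left = "\<lambda>i. isl (fst (p ! i))"
  have arcs: "set p \<subseteq> parcs (tail_head_graph G)" "p \<noteq> []"
    using assms(2) by (auto simp: H.closed_w_def)
  have flip: "?left (Suc i mod length p) \<longleftrightarrow> \<not> ?left i" if "i < length p" for i
    using H.closed_w_snd_eq_fst[OF assms(2) that] isl_snd_tail_head_arc[of "p ! i" G]
      subsetD[OF arcs(1) nth_mem[OF that]]
    by simp
  show ?thesis
  proof
    assume alt: "alternating c r s p"
    then have pair: "{?role i, ?role (Suc i mod length p)} = {r, s}" if "i < length p" for i
      using that by (simp add: alternating_def)
    have two: "?role i = r \<or> ?role i = s" if "i < length p" for i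
      using pair[OF that] by (metis insertCI insertE singletonD)
    have first: "0 < length p" using arcs(2) by simp
    \<comment> \<open>Both attributes flip from \<open>i\<close> to \<open>Suc i\<close>, so
      agreement with the first arc propagates along the list.\<close>
    have same: "?role i = ?role 0 \<longleftrightarrow> ?left i = ?left 0" if "i < length p" for i
      using that
    proof (induct i)
      case (Suc i)
      have i: "i < length p" and next_i: "Suc i mod length p = Suc i" using Suc.prems by simp_all
      have "?role (Suc i) \<noteq> ?role i"
        using pair[OF i] assms(3) unfolding next_i by (metis doubleton_eq_iff)
      moreover have "?left (Suc i) \<longleftrightarrow> \<not> ?left i" using flip[OF i] unfolding next_i .
      ultimately show ?case
        using Suc.hyps[OF i] two[OF i] two[OF Suc.prems] two[OF first] by metis
    qed simp
    \<comment> \<open>The role among \<open>r\<close> and \<open>s\<close> that the first arc does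
      not have. Whether it is \<open>t\<close> or \<open>t'\<close> depends on the side where the
      first arc starts.\<close>
    define o' where "o' = (if ?role 0 = r then s else r)"
    have "{?role 0, o'} = {r, s}" using two[OF first] by (auto simp: o'_def)
    moreover have "?role i = (if ?left i = ?left 0 then ?role 0 else o')" if "i < length p" for i
      using same[OF that] two[OF that] two[OF first] unfolding o'_def by metis
    then have "role_oriented c (if ?left 0 then ?role 0 else o') (if ?left 0 then o' else ?role 0) (set p)"
      by (simp add: role_oriented_def all_set_conv_all_nth)
    ultimately show "\<exists>t t'. {t, t'} = {r, s} \<and> role_oriented c t t' (set p)"
      by (cases "?left 0") (auto simp: insert_commute)
  next
    assume "\<exists>t t'. {t, t'} = {r, s} \<and> role_oriented c t t' (set p)"
    then obtain t t' where tt: "{t, t'} = {r, s}" "role_oriented c t t' (set p)" by blast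
    have "?role i = (if ?left i then t else t')" if "i < length p" for i
      using tt(2) that by (simp add: role_oriented_def)
    then show "alternating c r s p"
      using tt(1) flip arcs(2) unfolding alternating_def by (simp add: insert_commute)
  qed
qed

text \<open>At a tail copy the arcs of role \<open>t\<close> leave and those of role
  \<open>t'\<close> enter; at a head copy it is the other way round. Injectivity turns counts of
  arcs into counts of edges.\<close>

lemma balanced_role_oriented_iff:
  assumes "A \<subseteq> parcs (tail_head_graph G)" "inj_on tail_head_edge A"
    and "role_oriented c t t' A" "t \<noteq> t'"
  shows "balanced A \<longleftrightarrow>
    (\<forall>v. card {e \<in> tail_head_edge ` A. fst e = v \<and> c e = t} =
         card {e \<in> tail_head_edge ` A. fst e = v \<and> c e = t'}) \<and>
    (\<forall>v. card {e \<in> tail_head_edge ` A. snd e = v \<and> c e = t} =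
         card {e \<in> tail_head_edge ` A. snd e = v \<and> c e = t'})"
proof -
  have role: "c (tail_head_edge a) = t \<longleftrightarrow> isl (fst a)" "c (tail_head_edge a) = t' \<longleftrightarrow> \<not> isl (fst a)"
    if "a \<in> A" for a
    using that assms(3,4) by (auto simp: role_oriented_def)
  have ends: "(fst a = Inl v \<longleftrightarrow> fst (tail_head_edge a) = v \<and> isl (fst a)) \<and>
     (snd a = Inl v \<longleftrightarrow> fst (tail_head_edge a) = v \<and> \<not> isl (fst a)) \<and>
     (fst a = Inr v \<longleftrightarrow> snd (tail_head_edge a) = v \<and> \<not> isl (fst a)) \<and>
     (snd a = Inr v \<longleftrightarrow> snd (tail_head_edge a) = v \<and> isl (fst a))" if "a \<in> A" for a v
    using subsetD[OF assms(1) that] by (cases rule: tail_head_arc_cases) auto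
  have card_eq: "card {e \<in> tail_head_edge ` A. Q e} = card {a \<in> A. Q (tail_head_edge a)}" for Q
  proof -
    have "{e \<in> tail_head_edge ` A. Q e} = tail_head_edge ` {a \<in> A. Q (tail_head_edge a)}" by auto
    then show ?thesis using assms(2) by (auto intro!: card_image elim: inj_on_subset)
  qed
  have "{a \<in> A. fst (tail_head_edge a) = v \<and> c (tail_head_edge a) = t} = {a \<in> A. fst a = Inl v}"
    "{a \<in> A. fst (tail_head_edge a) = v \<and> c (tail_head_edge a) = t'} = {a \<in> A. snd a = Inl v}"
    "{a \<in> A. snd (tail_head_edge a) = v \<and> c (tail_head_edge a) = t} = {a \<in> A. snd a = Inr v}"
    "{a \<in> A. snd (tail_head_edge a) = v \<and> c (tail_head_edge a) = t'} = {a \<in> A. fst a = Inr v}" for v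
    using role ends by blast+
  then show ?thesis
    unfolding balanced_def card_eq by (auto simp: split_sum_all)
qed

section \<open>Role degrees under swaps\<close>

lemma card_swap_iff:
  assumes "finite E" "r \<noteq> s"
    and swap: "\<And>e. e \<in> E \<Longrightarrow> c' e \<noteq> c e \<Longrightarrow> c e = r \<and> c' e = s \<or> c e = s \<and> c' e = r"
  shows "card {e \<in> E. c' e = r} = card {e \<in> E. c e = r} \<longleftrightarrow>
    card {e \<in> E. c' e \<noteq> c e \<and> c e = r} = card {e \<in> E. c' e \<noteq> c e \<and> c e = s}"
proof -
  \<comment> \<open>\<open>?B\<close> keeps role \<open>r\<close> and cancels: before the change
    \<open>?R\<close> completes it to the edges of role \<open>r\<close>, afterwards
    \<open>?S\<close> does.\<close>
  let ?B = "{e \<in> E. c e = r \<and> c' e = r}"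
  let ?R = "{e \<in> E. c' e \<noteq> c e \<and> c e = r}" and ?S = "{e \<in> E. c' e \<noteq> c e \<and> c e = s}"
  have "{e \<in> E. c e = r} = ?B \<union> ?R" "{e \<in> E. c' e = r} = ?B \<union> ?S"
    using swap assms(2) by fastforce+
  moreover have "card (?B \<union> ?R) = card ?B + card ?R" "card (?B \<union> ?S) = card ?B + card ?S"
    using assms(1,2) by (auto intro!: card_Un_disjoint)
  ultimately show ?thesis by auto
qed

text \<open>Roles other than \<open>r\<close> and \<open>s\<close> keep their edges, and the
  conditions for \<open>r\<close> and \<open>s\<close> are the same equation by symmetry, so a
  single equation controls all of \<open>K\<close>.\<close>

lemma card_role_swap_iff:
  assumes "finite E" "r \<noteq> s" "r \<in> K" "s \<in> K"
    and swap: "\<And>e. e \<in> E \<Longrightarrow> c' e \<noteq> c e \<Longrightarrow> c e = r \<and> c' e = s \<or> c e = s \<and> c' e = r"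
  shows "(\<forall>k \<in> K. card {e \<in> E. c' e = k} = card {e \<in> E. c e = k}) \<longleftrightarrow>
    card {e \<in> E. c' e \<noteq> c e \<and> c e = r} = card {e \<in> E. c' e \<noteq> c e \<and> c e = s}"
    (is "?L \<longleftrightarrow> ?R")
proof
  assume ?L
  then show ?R using card_swap_iff[of E r s c' c] assms by blast
next
  assume R: ?R
  show ?L
  proof
    fix k assume "k \<in> K"
    consider "k = r" | "k = s" | "k \<noteq> r" "k \<noteq> s" by blast
    then show "card {e \<in> E. c' e = k} = card {e \<in> E. c e = k}"
    proof cases
      case 1
      then show ?thesis using card_swap_iff[of E r s c' c] assms R by blast
    next
      case 2
      then show ?thesis using card_swap_iff[of E s r c' c] assms R by metis
    next
      case 3
      then have "{e \<in> E. c' e = k} = {e \<in> E. c e = k}" using swap by fastforce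
      then show ?thesis by simp
    qed
  qed
qed

text \<open>The bridge for both directions of the theorem: \<open>A\<close> is the arc set of the
  given cycle in one, the set of oriented changed edges in the other.\<close>

lemma incidence_fibre_iff_balanced:
  assumes "pair_digraph G" "c' \<in> role_assignments G q" "t \<in> {1..q}" "t' \<in> {1..q}" "t \<noteq> t'"
    and swap: "\<And>e. e \<in> changed_edges G c c' \<Longrightarrow> c e = t \<and> c' e = t' \<or> c e = t' \<and> c' e = t"
    and A: "A \<subseteq> parcs (tail_head_graph G)" "inj_on tail_head_edge A" "role_oriented c t t' A"
      "tail_head_edge ` A = changed_edges G c c'"
  shows "c' \<in> incidence_fibre G q c \<longleftrightarrow> balanced A"
proof -
  interpret pair_digraph G by fact
  let ?D = "changed_edges G c c'"
  \<comment> \<open>With \<open>f\<close> equal to \<open>fst\<close> or \<open>snd\<close>, this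
    treats the edges leaving or entering \<open>v\<close>.\<close>
  have deg: "(\<forall>k \<in> {1..q}. card {e \<in> {e \<in> parcs G. f e = v}. c' e = k} =
        card {e \<in> {e \<in> parcs G. f e = v}. c e = k}) \<longleftrightarrow>
      card {e \<in> ?D. f e = v \<and> c e = t} = card {e \<in> ?D. f e = v \<and> c e = t'}"
    for f :: "'a \<times> 'a \<Rightarrow> 'a" and v
  proof -
    have "{e \<in> {e \<in> parcs G. f e = v}. c' e \<noteq> c e \<and> c e = k} = {e \<in> ?D. f e = v \<and> c e = k}" for k
      by (auto simp: changed_edges_def)
    then show ?thesis
      using card_role_swap_iff[of "{e \<in> parcs G. f e = v}" t t' "{1..q}" c' c] assms(3-5) swap
        pair_finite_arcs
      by (simp add: changed_edges_def)
  qed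
  \<comment> \<open>The fibre constrains only vertices of \<open>G\<close>, while
    \<open>balanced\<close> speaks of all elements of the type; at the others both counts are
    0.\<close>
  have outside: "{e \<in> ?D. fst e = v \<and> c e = k} = {}" "{e \<in> ?D. snd e = v \<and> c e = k} = {}"
    if "v \<notin> pverts G" for v k
    using that by (auto simp: changed_edges_def in_arcsD1 in_arcsD2)
  have "c' \<in> incidence_fibre G q c \<longleftrightarrow> (\<forall>v \<in> pverts G.
      card {e \<in> ?D. fst e = v \<and> c e = t} = card {e \<in> ?D. fst e = v \<and> c e = t'} \<and>
      card {e \<in> ?D. snd e = v \<and> c e = t} = card {e \<in> ?D. snd e = v \<and> c e = t'})"
    unfolding deg[symmetric] using assms(2)
    by (auto simp: incidence_fibre_def out_role_degree_def in_role_degree_def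
        out_arcs_def in_arcs_def)
  also have "\<dots> \<longleftrightarrow> balanced A"
    unfolding balanced_role_oriented_iff[OF A(1-3) assms(5)] A(4)
    using outside by (metis (lifting))
  finally show ?thesis .
qed

section \<open>Reversal along a cycle, and decomposition of the changed edges\<close>

theorem proposition2p1:
  fixes G :: "'a pair_pre_digraph" and q r s :: nat and c :: "'a \<times> 'a \<Rightarrow> nat"
  assumes "pair_digraph G"
    and "c \<in> role_assignments G q"
    and "r \<in> {1..q}" and "s \<in> {1..q}" and "r \<noteq> s"
  shows "(\<forall>p. th_cycle G p \<and> even (length p) \<and> alternating c r s p \<longrightarrow>
            reverse_roles r s (th_edges p) c \<in> incidence_fibre G q c \<and>
            reverse_roles r s (th_edges p) c \<noteq> c) \<and>
         (\<forall>c' \<in> incidence_fibre G q c.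
            (\<forall>e \<in> changed_edges G c c'. (c e = r \<and> c' e = s) \<or> (c e = s \<and> c' e = r)) \<longrightarrow>
            (\<exists>P. partition_on (changed_edges G c c') P \<and>
               (\<forall>T \<in> P. \<exists>p. th_closed_trail G p \<and> alternating c r s p \<and> T = th_edges p)) \<and>
            (\<exists>P. partition_on (changed_edges G c c') P \<and>
               (\<forall>T \<in> P. \<exists>p. th_cycle G p \<and> alternating c r s p \<and> T = th_edges p)))"
proof -
  interpret H: pair_graph "tail_head_graph G"
    using assms(1) by (rule pair_graph_tail_head_graph)
  have cycle_closed: "th_closed_trail G p" if "th_cycle G p" for p
    using that by (auto simp: th_cycle_def th_closed_trail_def H.cycle_def H.closed_w_def)
  have reverse: "reverse_roles r s (th_edges p) c \<in> incidence_fibre G q c \<and>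
      reverse_roles r s (th_edges p) c \<noteq> c"
    if cyc: "th_cycle G p" and alt: "alternating c r s p" for p
  proof -
    let ?c' = "reverse_roles r s (th_edges p) c"
    have p: "H.closed_w p" "distinct (map tail_head_edge p)"
      using cycle_closed[OF cyc] by (auto simp: th_closed_trail_def)
    have arcs: "set p \<subseteq> parcs (tail_head_graph G)" "p \<noteq> []"
      using p(1) by (auto simp: H.closed_w_def)
    obtain t t' where tt: "{t, t'} = {r, s}" "role_oriented c t t' (set p)"
      using alt alternating_iff_role_oriented[OF assms(1) p(1) assms(5)] by blast
    have sub: "th_edges p \<subseteq> parcs G"
      using image_mono[OF arcs(1), of tail_head_edge] unfolding tail_head_edge_image th_edges_def .
    have role: "c e = t \<or> c e = t'" if "e \<in> th_edges p" for e
      using that tt(2) by (auto simp: th_edges_def role_oriented_def)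
    \<comment> \<open>The cycle may run through its \<open>r\<close>-edges from tail to head or from
      head to tail, so both matchings of roles stay possible.\<close>
    have rs: "r = t \<and> s = t' \<or> r = t' \<and> s = t" using tt(1) by (auto simp: doubleton_eq_iff)
    have swapped: "c e = t \<and> ?c' e = t' \<or> c e = t' \<and> ?c' e = t" if "e \<in> th_edges p" for e
      using role[OF that] rs that by (auto simp: reverse_roles_def)
    have neq: "t \<noteq> t'" using rs assms(5) by auto
    have changed: "changed_edges G c ?c' = th_edges p"
    proof -
      have "?c' e = c e" if "e \<notin> th_edges p" for e using that by (simp add: reverse_roles_def)
      moreover have "?c' e \<noteq> c e" if "e \<in> th_edges p" for e using swapped[OF that] neq by metis
      ultimately show ?thesis
        using sub unfolding changed_edges_def by blast
    qed
    have "?c' \<in> role_assignments G q"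
      unfolding role_assignments_def
    proof (rule PiE_I)
      fix e assume "e \<in> parcs G"
      then have "c e \<in> {1..q}" using assms(2) by (auto simp: role_assignments_def)
      then show "?c' e \<in> {1..q}" using assms(3,4) by (simp add: reverse_roles_def transpose_def)
    next
      \<comment> \<open>Extensionality survives because the reversal only touches arcs of
        \<open>G\<close>.\<close>
      fix e assume "e \<notin> parcs G"
      moreover from this have "c e = undefined"
        using assms(2) unfolding role_assignments_def by (rule PiE_arb[rotated])
      moreover have "e \<notin> th_edges p" using sub \<open>e \<notin> parcs G\<close> by blast
      ultimately show "?c' e = undefined" by (simp add: reverse_roles_def)
    qed
    moreover have "balanced (set p)"
      using p by (intro H.balanced_set_closed_w) (auto simp: distinct_map)
    moreover have "t \<in> {1..q}" "t' \<in> {1..q}" using rs assms(3,4) by auto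
    moreover have "inj_on tail_head_edge (set p)" using p(2) by (simp add: distinct_map)
    moreover have "tail_head_edge ` set p = changed_edges G c ?c'"
      unfolding changed by (simp add: th_edges_def)
    moreover have "c e = t \<and> ?c' e = t' \<or> c e = t' \<and> ?c' e = t"
      if "e \<in> changed_edges G c ?c'" for e
      using that swapped unfolding changed by blast
    ultimately have "?c' \<in> incidence_fibre G q c"
      using incidence_fibre_iff_balanced[OF assms(1) _ _ _ neq _ arcs(1) _ tt(2)] by blast
    moreover have "?c' \<noteq> c"
      using swapped[of "tail_head_edge (hd p)"] neq arcs(2) by (metis th_edges_def hd_in_set imageI)
    ultimately show ?thesis by blast
  qed
  have decompose: "\<exists>P. partition_on (changed_edges G c c') P \<and>
      (\<forall>T \<in> P. \<exists>p. th_cycle G p \<and> alternating c r s p \<and> T = th_edges p)"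
    if c': "c' \<in> incidence_fibre G q c"
      and swap: "\<forall>e \<in> changed_edges G c c'. (c e = r \<and> c' e = s) \<or> (c e = s \<and> c' e = r)" for c'
  proof -
    let ?D = "changed_edges G c c'"
    \<comment> \<open>A right inverse of \<open>tail_head_edge\<close>, sending
      \<open>r\<close>-edges from tail to head. On changed edges the \<open>else\<close> branch
      means role \<open>s\<close>.\<close>
    define orient where
      "orient = (\<lambda>e. if c e = r then (Inl (fst e), Inr (snd e)) else (Inr (snd e), Inl (fst e)))"
    define A where "A = orient ` ?D"
    have edge: "tail_head_edge (orient e) = e"
      and side: "isl (fst (orient e)) \<longleftrightarrow> c e = r" for e
      by (simp_all add: orient_def)
    have A: "A \<subseteq> parcs (tail_head_graph G)" "inj_on tail_head_edge A" "role_oriented c r s A"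
        "tail_head_edge ` A = ?D"
    proof -
      show "A \<subseteq> parcs (tail_head_graph G)"
        by (force simp: A_def orient_def tail_head_graph_def changed_edges_def)
      show "inj_on tail_head_edge A" by (auto simp: A_def inj_on_def edge)
      show "role_oriented c r s A"
        using swap by (auto simp: A_def role_oriented_def edge side)
      show "tail_head_edge ` A = ?D" by (simp add: A_def image_image edge)
    qed
    have "c' \<in> role_assignments G q" using c' by (simp add: incidence_fibre_def)
    then have "balanced A"
      using incidence_fibre_iff_balanced[OF assms(1) _ assms(3-5) _ A] swap c' by blast
    moreover have "finite A" using A(1) H.pair_finite_arcs by (rule finite_subset)
    ultimately have "\<exists>P. partition_on A P \<and> (\<forall>C \<in> P. \<exists>p. H.cycle p \<and> set p = C)"
      using A(1) by (intro H.balanced_partition_cycles)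
    then obtain P where P: "partition_on A P" "\<forall>C \<in> P. \<exists>p. H.cycle p \<and> set p = C"
      by (elim exE conjE)
    have "\<exists>p. th_cycle G p \<and> alternating c r s p \<and> tail_head_edge ` C = th_edges p"
      if C: "C \<in> P" for C
    proof -
      from bspec[OF P(2) C] obtain p where p: "H.cycle p" "set p = C" by (elim exE conjE)
      have "set p \<subseteq> A" using partition_onD1[OF P(1)] C p(2) by blast
      \<comment> \<open>\<open>A\<close> contains only one of the two arcs of each undirected edge,
        so a directed cycle in \<open>A\<close> cannot run back along an edge and is a cycle in the
        undirected sense.\<close>
      then have "inj_on tail_head_edge (set p)" "role_oriented c r s (set p)"
        using A(2,3) by (auto simp: role_oriented_def elim: inj_on_subset)
      moreover have "distinct p" "H.closed_w p"
        using p(1) by (auto simp: H.cycle_conv H.closed_w_def)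
      ultimately have "th_cycle G p" "alternating c r s p"
        using p(1) alternating_iff_role_oriented[OF assms(1) _ assms(5), of p c]
        by (auto simp: th_cycle_def distinct_map)
      then show ?thesis using p(2) by (auto simp: th_edges_def)
    qed
    moreover have "partition_on ?D ((`) tail_head_edge ` P - {{}})"
      using partition_on_inj_image[OF P(1) A(2)] unfolding A(4) .
    ultimately show ?thesis
      by (intro exI[of _ "(`) tail_head_edge ` P - {{}}"]) blast
  qed
  show ?thesis
  proof (intro conjI allI ballI impI)
    fix p assume "th_cycle G p \<and> even (length p) \<and> alternating c r s p"
    then show "reverse_roles r s (th_edges p) c \<in> incidence_fibre G q c"
      "reverse_roles r s (th_edges p) c \<noteq> c"
      using reverse[of p] by simp_all
  next
    fix c' assume c': "c' \<in> incidence_fibre G q c"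
      "\<forall>e \<in> changed_edges G c c'. (c e = r \<and> c' e = s) \<or> (c e = s \<and> c' e = r)"
    from decompose[OF c'] show "\<exists>P. partition_on (changed_edges G c c') P \<and>
        (\<forall>T \<in> P. \<exists>p. th_cycle G p \<and> alternating c r s p \<and> T = th_edges p)" .
    \<comment> \<open>The partition into cycles also serves here, as each cycle is a closed
      trail.\<close>
    then show "\<exists>P. partition_on (changed_edges G c c') P \<and>
        (\<forall>T \<in> P. \<exists>p. th_closed_trail G p \<and> alternating c r s p \<and> T = th_edges p)"
      unfolding Ball_def
      by (elim ex_forward conj_forward all_forward imp_forward) (simp_all add: cycle_closed)
  qed
qed

end
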